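(* There is a polynomial $M_5$ in $t$ of degree $40$ such that the generating function for the number of spanning trees in the family $\mathcal{P}_5=\{P_n^5 : n\ge 7\}$ is, as a formal power series, $$\sum_{m=0}^{\infty}\tau(P_{m+7}^5)\,t^m=\frac{M_5}{E_5},$$ where \begin{align*} E_5=\;&(t - 1)(t^{8} + 3t^{7} + 6t^{6} - t^{5} + 15t^{4} - t^{3} + 6t^{2} + 3t + 1)\\ &(t^{16} - 5t^{15} + 10t^{14} - 10t^{13} - 28t^{12} + 10t^{11}+ 110t^{10} + 110t^{9} + 88t^{8} + 110t^{7} + 110t^{6} + 10t^{5} - 28t^{4} - 10t^{3} + 10t^{2} - 5t + 1)\\ &(t^{16} - 5t^{15} - 23t^{14}- 10t^{13} - 94t^{12} - 485t^{11} + 242t^{10} + 110t^{9} + 649t^{8} + 110t^{7} + 242t^{6} - 485t^{5} - 94t^{4} - 10t^{3} - 23t^{2}- 5t + 1). \end{align*}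
   Context: All graphs are finite and simple. $P_n$ is the path graph on $n$ vertices. For a graph $G$ and $k\ge1$, the $k$-th power $G^k$ has $V(G^k)=V(G)$, and $uv$ is an edge iff the distance between $u$ and $v$ in $G$ is at least $1$ and at most $k$. $\tau(G)$ is the number of labeled spanning trees of $G$ (isomorphic trees with different labels are counted as different). The family is $\mathcal{P}_k=\{P_n^k : k<\operatorname{diam} P_n\}=\{P_n^k : n\ge k+2\}$; the sequence is indexed so that the constant term of the generating function corresponds to the smallest member $n=k+2$. *)

theory Defs
  imports
    "HOL-Computational_Algebra.Computational_Algebra"
    "HOL-Library.Extended_Nat"
begin

record 'a ugraph =
  vertices :: "'a set"
  edges :: "'a set set"

definition simple_graph :: "'a ugraph \<Rightarrow> bool" where
  "simple_graph G \<longleftrightarrow>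
     finite (vertices G) \<and> (\<forall>e\<in>edges G. e \<subseteq> vertices G \<and> card e = 2)"

definition walk :: "'a ugraph \<Rightarrow> 'a list \<Rightarrow> bool" where
  "walk G xs \<longleftrightarrow> xs \<noteq> [] \<and> set xs \<subseteq> vertices G \<and>
     (\<forall>i. Suc i < length xs \<longrightarrow> {xs ! i, xs ! Suc i} \<in> edges G)"

definition walk_betw :: "'a ugraph \<Rightarrow> 'a \<Rightarrow> 'a list \<Rightarrow> 'a \<Rightarrow> bool" where
  "walk_betw G u xs v \<longleftrightarrow> walk G xs \<and> hd xs = u \<and> last xs = v"

text \<open>The distance is \<open>\<infinity>\<close> (the infimum of the empty set) between different components.\<close>

definition graph_dist :: "'a ugraph \<Rightarrow> 'a \<Rightarrow> 'a \<Rightarrow> enat" where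
  "graph_dist G u v = (INF xs\<in>{xs. walk_betw G u xs v}. enat (length xs - 1))"

definition graph_power :: "'a ugraph \<Rightarrow> nat \<Rightarrow> 'a ugraph" where
  "graph_power G k =
     \<lparr>vertices = vertices G,
      edges = {{u, v} |u v. u \<in> vertices G \<and> v \<in> vertices G \<and>
                 1 \<le> graph_dist G u v \<and> graph_dist G u v \<le> enat k}\<rparr>"

definition path_graph :: "nat \<Rightarrow> nat ugraph" where
  "path_graph n = \<lparr>vertices = {0..<n}, edges = {{i, Suc i} |i. Suc i < n}\<rparr>"

definition connected_graph :: "'a ugraph \<Rightarrow> bool" where
  "connected_graph G \<longleftrightarrow> vertices G \<noteq> {} \<and>
     (\<forall>u\<in>vertices G. \<forall>v\<in>vertices G. \<exists>xs. walk_betw G u xs v)"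

text \<open>A cycle is given by its vertices in cyclic order, without repeating the first one.\<close>

definition graph_cycle :: "'a ugraph \<Rightarrow> 'a list \<Rightarrow> bool" where
  "graph_cycle G xs \<longleftrightarrow>
     walk G xs \<and> distinct xs \<and> 3 \<le> length xs \<and> {last xs, hd xs} \<in> edges G"

definition tree_graph :: "'a ugraph \<Rightarrow> bool" where
  "tree_graph G \<longleftrightarrow> simple_graph G \<and> connected_graph G \<and> (\<nexists>xs. graph_cycle G xs)"

definition spanning_tree_of :: "'a ugraph \<Rightarrow> 'a ugraph \<Rightarrow> bool" where
  "spanning_tree_of T G \<longleftrightarrow>
     tree_graph T \<and> vertices T = vertices G \<and> edges T \<subseteq> edges G"

text \<open>Spanning trees are counted as subgraphs, not up to isomorphism.\<close>

definition num_spanning_trees :: "'a ugraph \<Rightarrow> nat" where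
  "num_spanning_trees G = card {T. spanning_tree_of T G}"

definition E5 :: "rat poly" where
  "E5 = (let t = [:0, 1:] in
     (t - 1) *
     (t^8 + 3 * t^7 + 6 * t^6 - t^5 + 15 * t^4 - t^3 + 6 * t^2 + 3 * t + 1) *
     (t^16 - 5 * t^15 + 10 * t^14 - 10 * t^13 - 28 * t^12 + 10 * t^11 + 110 * t^10
       + 110 * t^9 + 88 * t^8 + 110 * t^7 + 110 * t^6 + 10 * t^5 - 28 * t^4
       - 10 * t^3 + 10 * t^2 - 5 * t + 1) *
     (t^16 - 5 * t^15 - 23 * t^14 - 10 * t^13 - 94 * t^12 - 485 * t^11 + 242 * t^10
       + 110 * t^9 + 649 * t^8 + 110 * t^7 + 242 * t^6 - 485 * t^5 - 94 * t^4
       - 10 * t^3 - 23 * t^2 - 5 * t + 1))"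

lemma simple_graph_path_graph: "simple_graph (path_graph n)"
  by (auto simp: simple_graph_def path_graph_def)

lemma graph_dist_self:
  assumes "u \<in> vertices G"
  shows "graph_dist G u u = 0"
proof -
  have "walk_betw G u [u] u"
    using assms by (simp add: walk_betw_def walk_def)
  then have "graph_dist G u u \<le> enat (length [u] - 1)"
    unfolding graph_dist_def by (intro INF_lower) simp
  then show ?thesis
    by (simp add: zero_enat_def [symmetric])
qed

lemma simple_graph_graph_power:
  assumes "simple_graph G"
  shows "simple_graph (graph_power G k)"
proof -
  have "u \<noteq> v" if "u \<in> vertices G" "1 \<le> graph_dist G u v" for u v
    using that graph_dist_self [of u G] by auto
  then show ?thesis
    using assms by (fastforce simp: simple_graph_def graph_power_def)
qed

text \<open>As a power series \<open>E5\<close> is a unit, so dividing by it is exact.\<close>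

lemma fps_of_poly_E5_unit: "fps_nth (fps_of_poly E5) 0 = -1"
  by (simp add: E5_def Let_def poly_0_coeff_0 [symmetric])

end

theory Submission
  imports Defs
begin

text \<open>
Rationality of the generating function comes from deletion and contraction. For an edge \<open>e\<close> that is
not a loop, \<open>\<tau>(G) = \<tau>(G - e) + \<tau>(G / e)\<close>. Apply this to all edges at the last vertex of \<open>P\<^sub>n\<^sup>5\<close>, whose
neighbours are the five vertices before it. What is left is \<open>P\<^sub>n\<^sub>-\<^sub>1\<^sup>5\<close> with some of these five vertices
identified with each other; the branches in which the last vertex has become isolated contribute
nothing. The same happens if the last five vertices of \<open>P\<^sub>n\<^sup>5\<close> have themselves been identified according
to a partition \<open>\<pi>\<close>. So the 52 numbers \<open>\<tau>(P\<^sub>n\<^sup>5 / \<pi>)\<close>, where \<open>\<pi>\<close> runs through the partitions of the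
last five vertices, form a vector that is obtained from the vector for \<open>n - 1\<close> by a fixed integer
matrix \<open>A\<close> (\<open>window_count_Suc\<close>). Partitions are represented by lists of labels, and the combinatorial
link between labellings and trees is \<open>card_trees_eq_contraction_count\<close>.

Let \<open>v\<close> be the vector for \<open>n = 5\<close>. A finite computation shows that \<open>E5(A) v = 0\<close>
(\<open>horner_vector_E5\<close>); applying powers of \<open>A\<close> gives a linear recurrence of order 41 with the
coefficients of \<open>E5\<close>, valid for \<open>\<tau>(P\<^sub>n\<^sup>5)\<close> from \<open>n = 5\<close> on (\<open>window_count_recurrence\<close>). Since \<open>E5\<close> equals
its reciprocal polynomial up to the sign, this recurrence says that the product of \<open>E5\<close> with the
generating function has no terms of degree 41 or more, so it is a polynomial \<open>M\<^sub>5\<close>.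

The coefficient of \<open>t^40\<close> in the product is the recurrence that starts at \<open>n = 6\<close> with the term for
\<open>n = 6\<close> left out. Hence it is \<open>- \<tau>(P\<^sub>6\<^sup>5) = - 6^4 = - 1296\<close>, and the degree is exactly 40.
\<close>

section \<open>Forests and connectedness of edge sets\<close>

definition adj :: "'a set set \<Rightarrow> ('a \<times> 'a) set" where
  "adj F = {(u, v). {u, v} \<in> F}"

text \<open>Every edge is a bridge. In this form, unlike with cycles, adding one edge is easy to follow.\<close>

definition forest :: "'a set set \<Rightarrow> bool" where
  "forest F \<longleftrightarrow> (\<forall>u v. {u, v} \<in> F \<longrightarrow> (u, v) \<notin> (adj (F - {{u, v}}))\<^sup>*)"

definition tree_edges :: "'a set \<Rightarrow> 'a set set \<Rightarrow> bool" where
  "tree_edges V F \<longleftrightarrow> forest F \<and> (\<forall>u\<in>V. \<forall>v\<in>V. (u, v) \<in> (adj F)\<^sup>*)"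

lemma conn_sym: "(u, v) \<in> (adj F)\<^sup>* \<Longrightarrow> (v, u) \<in> (adj F)\<^sup>*"
proof -
  have "sym (adj F)"
    by (auto simp: adj_def sym_def insert_commute)
  then show "(u, v) \<in> (adj F)\<^sup>* \<Longrightarrow> (v, u) \<in> (adj F)\<^sup>*"
    by (meson sym_rtrancl symD)
qed

lemma conn_mono: "F \<subseteq> F' \<Longrightarrow> (u, v) \<in> (adj F)\<^sup>* \<Longrightarrow> (u, v) \<in> (adj F')\<^sup>*"
  by (rule rtrancl_mono[THEN subsetD]) (auto simp: adj_def)

text \<open>A walk using the new edge can be cut at its first and last use, so that at most one traversal of
the edge, in one of the two directions, has to be considered.\<close>

lemma conn_insert:
  "(x, y) \<in> (adj (insert {u, v} F))\<^sup>* \<longleftrightarrow>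
     (x, y) \<in> (adj F)\<^sup>* \<or> (x, u) \<in> (adj F)\<^sup>* \<and> (v, y) \<in> (adj F)\<^sup>* \<or>
     (x, v) \<in> (adj F)\<^sup>* \<and> (u, y) \<in> (adj F)\<^sup>*"
proof -
  have "adj (insert {u, v} F) = insert (u, v) (insert (v, u) (adj F))"
    by (auto simp: adj_def doubleton_eq_iff)
  then show ?thesis
    by (auto simp: rtrancl_insert) (meson conn_sym rtrancl_trans)+
qed

text \<open>A cycle through the new edge would connect its ends inside \<open>F\<close>. Conversely, if an old edge
\<open>{a, b}\<close> became redundant, the detour from \<open>a\<close> to \<open>b\<close> would have to use the new edge; closing
it up with \<open>{a, b}\<close> would connect the ends of the new edge inside \<open>F\<close>.\<close>

lemma forest_insert:
  assumes "{u, v} \<notin> F"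
  shows "forest (insert {u, v} F) \<longleftrightarrow> forest F \<and> (u, v) \<notin> (adj F)\<^sup>*"
proof
  assume L: "forest (insert {u, v} F)"
  have "insert {u, v} F - {{u, v}} = F"
    using assms by auto
  with L have "(u, v) \<notin> (adj F)\<^sup>*"
    unfolding forest_def by (metis insertI1)
  moreover have "forest F"
    unfolding forest_def
  proof (intro allI impI)
    fix a b assume ab: "{a, b} \<in> F"
    have "(a, b) \<notin> (adj (insert {u, v} F - {{a, b}}))\<^sup>*"
      using L ab unfolding forest_def by blast
    then show "(a, b) \<notin> (adj (F - {{a, b}}))\<^sup>*"
      using conn_mono[of "F - {{a, b}}" "insert {u, v} F - {{a, b}}"] by blast
  qed
  ultimately show "forest F \<and> (u, v) \<notin> (adj F)\<^sup>*"
    by blast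
next
  assume R: "forest F \<and> (u, v) \<notin> (adj F)\<^sup>*"
  show "forest (insert {u, v} F)"
    unfolding forest_def
  proof (intro allI impI notI)
    fix a b
    assume ab: "{a, b} \<in> insert {u, v} F" and c: "(a, b) \<in> (adj (insert {u, v} F - {{a, b}}))\<^sup>*"
    show False
    proof (cases "{a, b} = {u, v}")
      case True
      then have "(a, b) \<in> (adj F)\<^sup>*"
        using c assms by simp
      then show False
        using True R conn_sym by (metis doubleton_eq_iff)
    next
      case False
      then have abF: "{a, b} \<in> F"
        using ab by simp
      have eq: "insert {u, v} F - {{a, b}} = insert {u, v} (F - {{a, b}})"
        using False by auto
      have sub: "(x, y) \<in> (adj F)\<^sup>*" if "(x, y) \<in> (adj (F - {{a, b}}))\<^sup>*" for x y
        using conn_mono[OF _ that] by blast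
      have "(a, b) \<in> (adj F)\<^sup>*"
        using abF by (auto simp: adj_def)
      moreover have "(a, b) \<notin> (adj (F - {{a, b}}))\<^sup>*"
        using R abF unfolding forest_def by blast
      ultimately show False
        using c R sub conn_sym rtrancl_trans unfolding eq conn_insert by metis
    qed
  qed
qed

lemma forest_subset:
  assumes "forest F'" "F \<subseteq> F'"
  shows "forest F"
  unfolding forest_def
proof (intro allI impI)
  fix u v assume "{u, v} \<in> F"
  then have "(u, v) \<notin> (adj (F' - {{u, v}}))\<^sup>*"
    using assms unfolding forest_def by blast
  then show "(u, v) \<notin> (adj (F - {{u, v}}))\<^sup>*"
    using conn_mono[of "F - {{u, v}}" "F' - {{u, v}}"] assms(2) by blast
qed

section \<open>Deletion and contraction on labelled vertices\<close>

text \<open>The number of spanning trees of the multigraph obtained from the edge list by identifying all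
vertices of \<open>V\<close> with equal labels, computed by deletion and contraction. Keeping the vertex set and
changing only the labels avoids quotient graphs: contracting an edge merges two labels.\<close>

fun contraction_count :: "'v set \<Rightarrow> ('v \<times> 'v) list \<Rightarrow> ('v \<Rightarrow> 'l) \<Rightarrow> nat" where
  "contraction_count V [] lab = (if \<forall>x\<in>V. \<forall>y\<in>V. lab x = lab y then 1 else 0)"
| "contraction_count V ((u, v) # es) lab = contraction_count V es lab +
     (if lab u = lab v then 0
      else contraction_count V es (\<lambda>x. if lab x = lab u then lab v else lab x))"

abbreviation edge_list_set :: "('v \<times> 'v) list \<Rightarrow> 'v set set" where
  "edge_list_set es \<equiv> set (map (\<lambda>(u, v). {u, v}) es)"

text \<open>The labels record the components of a forest \<open>F\<^sub>0\<close> of edges that have already been selected. The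
generality in \<open>F\<^sub>0\<close> is what the induction needs: a tree either avoids the first edge, or contains it
and then extends \<open>F\<^sub>0\<close> with that edge, which is possible only if its ends carry different labels.\<close>

lemma card_trees_eq_contraction_count:
  assumes "distinct (map (\<lambda>(u, v). {u, v}) es)" "F\<^sub>0 \<inter> edge_list_set es = {}" "forest F\<^sub>0"
    and "\<And>x y. x \<in> V \<Longrightarrow> y \<in> V \<Longrightarrow> lab x = lab y \<longleftrightarrow> (x, y) \<in> (adj F\<^sub>0)\<^sup>*"
    and "set es \<subseteq> V \<times> V"
  shows "card {F. F \<subseteq> edge_list_set es \<and> tree_edges V (F\<^sub>0 \<union> F)} = contraction_count V es lab"
  using assms
proof (induction es arbitrary: F\<^sub>0 lab)
  case Nil
  have "tree_edges V F\<^sub>0 \<longleftrightarrow> (\<forall>x\<in>V. \<forall>y\<in>V. lab x = lab y)"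
    using Nil.prems(3) by (simp add: tree_edges_def Nil.prems(4))
  then have "contraction_count V [] lab = (if tree_edges V F\<^sub>0 then 1 else 0)"
    by (simp only: contraction_count.simps)
  moreover have "{F. F \<subseteq> edge_list_set [] \<and> tree_edges V (F\<^sub>0 \<union> F)} =
      (if tree_edges V F\<^sub>0 then {{}} else {})"
    by auto
  ultimately show ?case
    by (simp only:) simp
next
  case (Cons e es)
  obtain u v where e: "e = (u, v)"
    by (cases e)
  let ?E = "edge_list_set es"
  let ?e = "{u, v}"
  have uv: "u \<in> V" "v \<in> V" and new: "?e \<notin> ?E" "?e \<notin> F\<^sub>0"
    using Cons.prems by (auto simp: e)
  let ?without = "{F. F \<subseteq> ?E \<and> tree_edges V (F\<^sub>0 \<union> F)}"
  let ?with = "{F. F \<subseteq> ?E \<and> tree_edges V (insert ?e F\<^sub>0 \<union> F)}"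
  have fin: "finite ?without" "finite ?with"
    by (auto intro: finite_subset[of _ "Pow ?E"])
  have split: "{F. F \<subseteq> edge_list_set (e # es) \<and> tree_edges V (F\<^sub>0 \<union> F)} =
      ?without \<union> insert ?e ` ?with" (is "?all = _")
  proof (intro equalityI subsetI)
    fix F assume F: "F \<in> ?all"
    show "F \<in> ?without \<union> insert ?e ` ?with"
    proof (cases "?e \<in> F")
      case True
      then have eq: "insert ?e (F - {?e}) = F" "insert ?e F\<^sub>0 \<union> (F - {?e}) = F\<^sub>0 \<union> F"
        by auto
      have "F - {?e} \<subseteq> ?E"
        using F by (auto simp: e)
      moreover have "tree_edges V (insert ?e F\<^sub>0 \<union> (F - {?e}))"
        unfolding eq(2) using F by simp
      ultimately have "F - {?e} \<in> ?with"
        by simp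
      then have "insert ?e (F - {?e}) \<in> insert ?e ` ?with"
        by (rule imageI)
      then show ?thesis
        unfolding eq(1) by (rule UnI2)
    qed (use F in \<open>auto simp: e\<close>)
  qed (auto simp: e)
  have "inj_on (insert ?e) ?with"
    using new(1) by (intro inj_onI) (metis (no_types, lifting) Diff_insert_absorb mem_Collect_eq subsetD)
  moreover have "?without \<inter> insert ?e ` ?with = {}"
    using new by auto
  ultimately have card: "card ?all = card ?without + card ?with"
    unfolding split using fin by (simp add: card_Un_disjoint card_image)
  have without: "card ?without = contraction_count V es lab"
    using Cons.prems by (intro Cons.IH) (auto simp: e)
  have lab_uv: "lab u = lab v \<longleftrightarrow> (u, v) \<in> (adj F\<^sub>0)\<^sup>*"
    using Cons.prems(4) uv by blast
  show ?case
  proof (cases "lab u = lab v")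
    case True
    then have "\<not> forest (insert ?e F\<^sub>0)"
      using lab_uv new by (simp add: forest_insert)
    then have "?with = {}"
      using forest_subset[of _ "insert ?e F\<^sub>0"] by (auto simp: tree_edges_def)
    then show ?thesis
      using card without True by (simp add: e)
  next
    case False
    have "card ?with = contraction_count V es (\<lambda>x. if lab x = lab u then lab v else lab x)"
    proof (rule Cons.IH)
      show "forest (insert ?e F\<^sub>0)"
        using Cons.prems(3) False lab_uv new by (simp add: forest_insert)
      fix x y assume xy: "x \<in> V" "y \<in> V"
      show "((if lab x = lab u then lab v else lab x) = (if lab y = lab u then lab v else lab y))
          \<longleftrightarrow> (x, y) \<in> (adj (insert ?e F\<^sub>0))\<^sup>*"
        using xy uv False unfolding conn_insert
        by (simp flip: Cons.prems(4))
    qed (use Cons.prems new in \<open>auto simp: e\<close>)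
    then show ?thesis
      using card without False by (simp add: e)
  qed
qed

section \<open>Trees as connected forests\<close>

lemma walk_imp_conn:
  assumes "walk_betw G u xs v" "\<And>i. Suc i < length xs \<Longrightarrow> {xs ! i, xs ! Suc i} \<in> F"
  shows "(u, v) \<in> (adj F)\<^sup>*"
proof -
  have "i < length xs \<Longrightarrow> (xs ! 0, xs ! i) \<in> (adj F)\<^sup>*" for i
  proof (induction i)
    case (Suc i)
    then have "(xs ! i, xs ! Suc i) \<in> adj F"
      using assms(2) by (simp add: adj_def)
    with Suc show ?case
      by (meson Suc_lessD rtrancl.rtrancl_into_rtrancl)
  qed simp
  moreover have "xs \<noteq> []" "hd xs = u" "last xs = v"
    using assms(1) by (auto simp: walk_betw_def walk_def)
  ultimately show ?thesis
    by (metis diff_less hd_conv_nth last_conv_nth length_greater_0_conv zero_less_one)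
qed

text \<open>Repetition is avoided while the walk is built: when the next vertex already occurs, the walk is cut
back to that occurrence.\<close>

lemma conn_imp_distinct_walk:
  assumes "(u, v) \<in> (adj F)\<^sup>*" "u \<in> V" "\<Union>F \<subseteq> V"
  shows "\<exists>xs. walk_betw \<lparr>vertices = V, edges = F\<rparr> u xs v \<and> distinct xs"
  using assms(1)
proof (induction rule: rtrancl_induct)
  case base
  then show ?case
    using assms(2) by (intro exI[of _ "[u]"]) (simp add: walk_betw_def walk_def)
next
  case (step v w)
  obtain xs where xs: "walk_betw \<lparr>vertices = V, edges = F\<rparr> u xs v" "distinct xs"
    using step.IH by blast
  have w: "{v, w} \<in> F" "w \<in> V"
    using step.hyps(2) assms(3) by (auto simp: adj_def)
  have ne: "xs \<noteq> []" "last xs = v" "hd xs = u"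
    using xs(1) by (auto simp: walk_betw_def walk_def)
  show ?case
  proof (cases "w \<in> set xs")
    case True
    then obtain ys zs where s: "xs = ys @ w # zs"
      by (meson split_list)
    have "walk_betw \<lparr>vertices = V, edges = F\<rparr> u (ys @ [w]) w"
      using xs(1) unfolding walk_betw_def walk_def s
      by (auto simp: nth_append hd_append split: if_splits)
    then show ?thesis
      using xs(2) s by (intro exI[of _ "ys @ [w]"]) auto
  next
    case False
    have "walk_betw \<lparr>vertices = V, edges = F\<rparr> u (xs @ [w]) w"
      unfolding walk_betw_def walk_def
    proof (intro conjI allI impI)
      fix i assume i: "Suc i < length (xs @ [w])"
      show "{(xs @ [w]) ! i, (xs @ [w]) ! Suc i} \<in> edges \<lparr>vertices = V, edges = F\<rparr>"
      proof (cases "Suc i < length xs")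
        case True
        then show ?thesis
          using xs(1) by (simp add: walk_betw_def walk_def nth_append)
      next
        case False
        then have "i = length xs - 1" "Suc i = length xs"
          using i by auto
        then have "(xs @ [w]) ! Suc i = w" "(xs @ [w]) ! i = v"
          using ne(2) last_conv_nth[OF ne(1)] by (simp_all add: nth_append)
        then show ?thesis
          using w(1) by simp
      qed
    qed (use xs(1) w ne in \<open>auto simp: walk_betw_def walk_def\<close>)
    then show ?thesis
      using xs(2) False by (intro exI[of _ "xs @ [w]"]) auto
  qed
qed

text \<open>The closing edge of a cycle is bypassed by the rest of the cycle. Conversely, a detour around an
edge, taken without repetition, has at least three vertices (two would force the removed edge
itself), so it closes up to a cycle.\<close>

lemma forest_iff_no_cycle:
  assumes "simple_graph \<lparr>vertices = V, edges = F\<rparr>"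
  shows "forest F \<longleftrightarrow> (\<nexists>xs. graph_cycle \<lparr>vertices = V, edges = F\<rparr> xs)"
proof
  assume forest: "forest F"
  show "\<nexists>xs. graph_cycle \<lparr>vertices = V, edges = F\<rparr> xs"
  proof
    assume "\<exists>xs. graph_cycle \<lparr>vertices = V, edges = F\<rparr> xs"
    then obtain xs where walk: "walk \<lparr>vertices = V, edges = F\<rparr> xs" and dist: "distinct xs"
      and len: "3 \<le> length xs" and closing: "{last xs, hd xs} \<in> F"
      by (auto simp: graph_cycle_def)
    have "xs \<noteq> []"
      using len by auto
    have "{xs ! i, xs ! Suc i} \<in> F - {{hd xs, last xs}}" if i: "Suc i < length xs" for i
    proof -
      have "{xs ! i, xs ! Suc i} \<noteq> {xs ! 0, xs ! (length xs - 1)}"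
      proof
        assume "{xs ! i, xs ! Suc i} = {xs ! 0, xs ! (length xs - 1)}"
        then consider "xs ! i = xs ! 0" "xs ! Suc i = xs ! (length xs - 1)"
          | "xs ! i = xs ! (length xs - 1)"
          by (auto simp: doubleton_eq_iff)
        then show False
        proof cases
          case 1
          then have "i = 0" "Suc i = length xs - 1"
            using i len nth_eq_iff_index_eq[OF dist, of i 0]
              nth_eq_iff_index_eq[OF dist, of "Suc i" "length xs - 1"] by linarith+
          then show False
            using len by simp
        next
          case 2
          then show False
            using i len nth_eq_iff_index_eq[OF dist, of i "length xs - 1"] by linarith
        qed
      qed
      then show ?thesis
        using walk i by (simp add: walk_def hd_conv_nth last_conv_nth)
    qed
    moreover have "walk_betw \<lparr>vertices = V, edges = F\<rparr> (hd xs) xs (last xs)"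
      using walk by (simp add: walk_betw_def)
    ultimately have "(hd xs, last xs) \<in> (adj (F - {{hd xs, last xs}}))\<^sup>*"
      by (rule walk_imp_conn[rotated])
    then show False
      using forest closing unfolding forest_def by (metis insert_commute)
  qed
next
  assume acyclic: "\<nexists>xs. graph_cycle \<lparr>vertices = V, edges = F\<rparr> xs"
  show "forest F"
    unfolding forest_def
  proof (intro allI impI notI)
    fix u v assume uv: "{u, v} \<in> F" and conn: "(u, v) \<in> (adj (F - {{u, v}}))\<^sup>*"
    have V: "{u, v} \<subseteq> V" "card {u, v} = 2" "\<Union>F \<subseteq> V"
      using assms uv by (auto simp: simple_graph_def)
    then have "u \<noteq> v"
      by auto
    obtain xs where xs: "walk_betw \<lparr>vertices = V, edges = F - {{u, v}}\<rparr> u xs v" "distinct xs"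
      using conn_imp_distinct_walk[OF conn, of V] V by blast
    then have ends: "xs \<noteq> []" "xs ! 0 = u" "xs ! (length xs - 1) = v"
      by (auto simp: walk_betw_def walk_def hd_conv_nth last_conv_nth)
    have "length xs \<noteq> 1"
      using ends \<open>u \<noteq> v\<close> by auto
    moreover have "length xs \<noteq> 2"
    proof
      assume "length xs = 2"
      then have "{xs ! 0, xs ! Suc 0} \<in> F - {{u, v}}" "xs ! Suc 0 = v"
        using xs(1) ends by (auto simp: walk_betw_def walk_def)
      then show False
        using ends by simp
    qed
    ultimately have "3 \<le> length xs"
      using ends(1) by (cases "length xs"; simp; presburger)
    then have "graph_cycle \<lparr>vertices = V, edges = F\<rparr> xs"
      using xs uv by (auto simp: graph_cycle_def walk_betw_def walk_def insert_commute)
    then show False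
      using acyclic by blast
  qed
qed

lemma tree_graph_iff_tree_edges:
  assumes "simple_graph \<lparr>vertices = V, edges = F\<rparr>" "V \<noteq> {}"
  shows "tree_graph \<lparr>vertices = V, edges = F\<rparr> \<longleftrightarrow> tree_edges V F"
proof -
  have "\<Union>F \<subseteq> V"
    using assms(1) by (auto simp: simple_graph_def)
  have reach: "(\<exists>xs. walk_betw \<lparr>vertices = V, edges = F\<rparr> u xs v) \<longleftrightarrow> (u, v) \<in> (adj F)\<^sup>*"
    if "u \<in> V" for u v
  proof
    assume "\<exists>xs. walk_betw \<lparr>vertices = V, edges = F\<rparr> u xs v"
    then obtain xs where xs: "walk_betw \<lparr>vertices = V, edges = F\<rparr> u xs v"
      by blast
    then show "(u, v) \<in> (adj F)\<^sup>*"
      by (rule walk_imp_conn) (use xs in \<open>simp add: walk_betw_def walk_def\<close>)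
  next
    assume "(u, v) \<in> (adj F)\<^sup>*"
    then show "\<exists>xs. walk_betw \<lparr>vertices = V, edges = F\<rparr> u xs v"
      using conn_imp_distinct_walk[OF _ that \<open>\<Union>F \<subseteq> V\<close>] by metis
  qed
  show ?thesis
    unfolding tree_graph_def connected_graph_def tree_edges_def forest_iff_no_cycle[OF assms(1)]
    using assms by (auto simp: reach)
qed

lemma num_spanning_trees_eq_card:
  fixes G :: "'a ugraph"
  assumes "simple_graph G" "vertices G \<noteq> {}"
  shows "num_spanning_trees G = card {F. F \<subseteq> edges G \<and> tree_edges (vertices G) F}"
proof -
  let ?g = "\<lambda>F. \<lparr>vertices = vertices G, edges = F\<rparr> :: 'a ugraph"
  have simple: "simple_graph (?g F)" if "F \<subseteq> edges G" for F
    using that assms(1) by (auto simp: simple_graph_def)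
  have "{T. spanning_tree_of T G} = ?g ` {F. F \<subseteq> edges G \<and> tree_edges (vertices G) F}"
  proof (intro equalityI subsetI)
    fix T assume T: "T \<in> {T. spanning_tree_of T G}"
    then obtain F where F: "T = ?g F"
      by (cases T) (simp add: spanning_tree_of_def)
    with T have "F \<subseteq> edges G" "tree_graph (?g F)"
      by (simp_all add: spanning_tree_of_def)
    then have "tree_edges (vertices G) F" "F \<subseteq> edges G"
      using tree_graph_iff_tree_edges[OF simple assms(2)] by blast+
    with F show "T \<in> ?g ` {F. F \<subseteq> edges G \<and> tree_edges (vertices G) F}"
      by blast
  next
    fix T assume "T \<in> ?g ` {F. F \<subseteq> edges G \<and> tree_edges (vertices G) F}"
    then show "T \<in> {T. spanning_tree_of T G}"
      using tree_graph_iff_tree_edges[OF simple assms(2)] by (auto simp: spanning_tree_of_def)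
  qed
  moreover have "inj ?g"
    by (auto intro: injI)
  ultimately show ?thesis
    unfolding num_spanning_trees_def by (simp add: card_image inj_on_def)
qed

section \<open>Powers of paths\<close>

text \<open>Walking monotonically realises the bound; no walk is shorter, since each step changes the vertex
number by one.\<close>

lemma graph_dist_path_graph:
  assumes "u < n" "v < n"
  shows "graph_dist (path_graph n) u v = enat ((u - v) + (v - u))"
proof (rule antisym)
  let ?d = "(u - v) + (v - u)" and ?w = "\<lambda>i. if u \<le> v then u + i else u - i"
  let ?xs = "map ?w [0..<Suc ?d]"
  have "{?xs ! i, ?xs ! Suc i} \<in> edges (path_graph n)" if "Suc i < length ?xs" for i
  proof (cases "u \<le> v")
    case True
    then show ?thesis
      using that assms by (auto simp: path_graph_def simp del: upt_Suc)
  next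
    case False
    then have "?xs ! i = Suc (u - Suc i)" "?xs ! Suc i = u - Suc i" "Suc (u - Suc i) < n"
      using that assms by (auto simp del: upt_Suc)
    then show ?thesis
      unfolding path_graph_def by (auto simp: insert_commute)
  qed
  moreover have "set ?xs \<subseteq> vertices (path_graph n)"
    using assms by (auto simp: path_graph_def)
  moreover have "hd ?xs = u" "last ?xs = v"
    by (simp_all add: hd_map last_map hd_upt del: upt_Suc)
  ultimately have "walk_betw (path_graph n) u ?xs v"
    by (simp add: walk_betw_def walk_def del: upt_Suc)
  moreover have "length ?xs - 1 = ?d"
    by simp
  ultimately have "\<exists>xs. walk_betw (path_graph n) u xs v \<and> length xs - 1 = ?d"
    by blast
  then show "graph_dist (path_graph n) u v \<le> enat ((u - v) + (v - u))"
    unfolding graph_dist_def by (metis (mono_tags, lifting) INF_lower mem_Collect_eq)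
next
  show "enat ((u - v) + (v - u)) \<le> graph_dist (path_graph n) u v"
    unfolding graph_dist_def
  proof (rule INF_greatest)
    fix xs assume "xs \<in> {xs. walk_betw (path_graph n) u xs v}"
    then have xs: "xs \<noteq> []" "xs ! 0 = u" "xs ! (length xs - 1) = v"
      and edge: "\<And>i. Suc i < length xs \<Longrightarrow> {xs ! i, xs ! Suc i} \<in> edges (path_graph n)"
      by (auto simp: walk_betw_def walk_def hd_conv_nth last_conv_nth)
    have "i < length xs \<Longrightarrow> (u - xs ! i) + (xs ! i - u) \<le> i" for i
    proof (induction i)
      case (Suc i)
      have "xs ! Suc i = Suc (xs ! i) \<or> xs ! i = Suc (xs ! Suc i)"
        using edge[OF Suc.prems] by (auto simp: path_graph_def doubleton_eq_iff)
      then show ?case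
        using Suc by auto
    qed (simp add: xs)
    from this[of "length xs - 1"] show "enat ((u - v) + (v - u)) \<le> enat (length xs - 1)"
      using xs by simp
  qed
qed

text \<open>The edges of the fifth power, grouped by their larger end, from the last vertex downwards. This is
the order in which vertices are eliminated below. Natural subtraction makes the first vertices
adjacent to all their predecessors.\<close>

fun band_edges :: "nat \<Rightarrow> (nat \<times> nat) list" where
  "band_edges 0 = []"
| "band_edges (Suc n) = map (\<lambda>j. (n, j)) (rev [n - 5..<n]) @ band_edges n"

lemma set_band_edges: "set (band_edges n) = {(i, j). i < n \<and> j < i \<and> i \<le> j + 5}"
  by (induction n) (auto simp: less_Suc_eq)

lemma distinct_band_edges: "distinct (map (\<lambda>(u, v). {u, v}) (band_edges n))"
proof (induction n)
  case (Suc n)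
  have "distinct (map (\<lambda>j. {n, j}) (rev [n - 5..<n]))"
    by (simp add: distinct_map inj_on_def doubleton_eq_iff del: upt_Suc)
  with Suc show ?case
    by (fastforce simp: o_def set_band_edges doubleton_eq_iff)
qed simp

lemma edges_path_power: "edges (graph_power (path_graph n) 5) = edge_list_set (band_edges n)"
proof -
  have "u \<in> vertices (path_graph n) \<and> v \<in> vertices (path_graph n) \<and>
      1 \<le> graph_dist (path_graph n) u v \<and> graph_dist (path_graph n) u v \<le> enat 5 \<longleftrightarrow>
      u < n \<and> v < n \<and> u \<noteq> v \<and> (u - v) + (v - u) \<le> 5" for u v
    by (auto simp: path_graph_def[of n, THEN arg_cong[where f = vertices]]
        graph_dist_path_graph one_enat_def)
  then have "edges (graph_power (path_graph n) 5) =
      {{u, v} |u v. u < n \<and> v < n \<and> u \<noteq> v \<and> (u - v) + (v - u) \<le> 5}"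
    by (simp add: graph_power_def)
  also have "\<dots> = {{i, j} |i j. i < n \<and> j < i \<and> i \<le> j + 5}"
  proof (intro equalityI subsetI)
    fix e assume "e \<in> {{u, v} |u v. u < n \<and> v < n \<and> u \<noteq> v \<and> (u - v) + (v - u) \<le> 5}"
    then obtain u v where "e = {u, v}" "u < n" "v < n" "u \<noteq> v" "(u - v) + (v - u) \<le> 5"
      by blast
    then have "e = {max u v, min u v} \<and> max u v < n \<and> min u v < max u v \<and> max u v \<le> min u v + 5"
      by (auto simp: max_def min_def)
    then show "e \<in> {{i, j} |i j. i < n \<and> j < i \<and> i \<le> j + 5}"
      by blast
  qed fastforce
  also have "\<dots> = edge_list_set (band_edges n)"
    by (simp only: set_map set_band_edges) auto
  finally show ?thesis .
qed

lemma num_spanning_trees_path_power: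
  assumes "0 < n"
  shows "num_spanning_trees (graph_power (path_graph n) 5) =
           contraction_count {..<n} (band_edges n) id"
proof -
  have V: "vertices (graph_power (path_graph n) 5) = {..<n}"
    by (auto simp: graph_power_def path_graph_def)
  have "num_spanning_trees (graph_power (path_graph n) 5) =
      card {F. F \<subseteq> edge_list_set (band_edges n) \<and> tree_edges {..<n} ({} \<union> F)}"
    using assms num_spanning_trees_eq_card[OF simple_graph_graph_power[OF simple_graph_path_graph]]
    by (simp add: V edges_path_power lessThan_empty_iff)
  also have "\<dots> = contraction_count {..<n} (band_edges n) id"
    by (rule card_trees_eq_contraction_count)
       (auto simp: distinct_band_edges set_band_edges forest_def adj_def)
  finally show ?thesis .
qed

section \<open>Elimination of vertices\<close>

lemma contraction_count_cong:
  assumes "\<And>x y. x \<in> V \<Longrightarrow> y \<in> V \<Longrightarrow> lab x = lab y \<longleftrightarrow> lab' x = lab' y" "set es \<subseteq> V \<times> V"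
  shows "contraction_count V es lab = contraction_count V es lab'"
  using assms
proof (induction es arbitrary: lab lab')
  case (Cons e es)
  obtain u v where e: "e = (u, v)"
    by (cases e)
  then have uv: "u \<in> V" "v \<in> V" and es: "set es \<subseteq> V \<times> V"
    using Cons.prems(2) by auto
  have "contraction_count V es lab = contraction_count V es lab'"
    using Cons.IH Cons.prems(1) es by blast
  moreover have "contraction_count V es (\<lambda>x. if lab x = lab u then lab v else lab x) =
      contraction_count V es (\<lambda>x. if lab' x = lab' u then lab' v else lab' x)"
    by (rule Cons.IH) (use Cons.prems(1) uv es in auto)
  moreover have "lab u = lab v \<longleftrightarrow> lab' u = lab' v"
    using Cons.prems(1) uv by blast
  ultimately show ?case
    by (simp add: e)
next
  case Nil
  have "(\<forall>x\<in>V. \<forall>y\<in>V. lab x = lab y) \<longleftrightarrow> (\<forall>x\<in>V. \<forall>y\<in>V. lab' x = lab' y)"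
    using Nil.prems(1) by blast
  then show ?case
    by (simp only: contraction_count.simps)
qed

text \<open>Together with the next lemma: once all edges at a vertex have been treated, the vertex is harmless
if it has been merged with another one, and otherwise it can no longer be connected to the rest.\<close>

lemma contraction_count_drop:
  assumes "v \<in> V" "w \<in> V" "v \<noteq> w" "lab v = lab w" "set es \<subseteq> (V - {v}) \<times> (V - {v})"
  shows "contraction_count V es lab = contraction_count (V - {v}) es lab"
  using assms
proof (induction es arbitrary: lab)
  case Nil
  have "(\<forall>x\<in>V. \<forall>y\<in>V. lab x = lab y) \<longleftrightarrow> (\<forall>x\<in>V - {v}. \<forall>y\<in>V - {v}. lab x = lab y)"
    using Nil.prems by (metis DiffE DiffI singletonD)
  then show ?case
    by (simp only: contraction_count.simps)
next
  case (Cons e es)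
  then show ?case
    by (cases e) auto
qed

lemma contraction_count_isolated:
  assumes "v \<in> V" "w \<in> V" "v \<noteq> w" "\<And>x. x \<in> V - {v} \<Longrightarrow> lab x \<noteq> lab v"
    and "set es \<subseteq> (V - {v}) \<times> (V - {v})"
  shows "contraction_count V es lab = 0"
  using assms
proof (induction es arbitrary: lab)
  case Nil
  then have "lab w \<noteq> lab v"
    by blast
  with Nil.prems(1,2) show ?case
    by (metis contraction_count.simps(1))
next
  case (Cons e es)
  obtain a b where e: "e = (a, b)"
    by (cases e)
  then have ab: "a \<in> V - {v}" "b \<in> V - {v}" and es: "set es \<subseteq> (V - {v}) \<times> (V - {v})"
    using Cons.prems(5) by auto
  then have "lab a \<noteq> lab v" "lab b \<noteq> lab v"
    using Cons.prems(4) by blast+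
  then have "contraction_count V es (\<lambda>x. if lab x = lab a then lab b else lab x) = 0"
    using Cons.prems(4) by (intro Cons.IH[OF Cons.prems(1-3) _ es]) auto
  moreover have "contraction_count V es lab = 0"
    using Cons.IH[of lab] Cons.prems(1-4) es by blast
  ultimately show ?case
    by (simp add: e)
qed

text \<open>The list \<open>ys\<close> holds the labels of consecutive vertices. The result lists the labellings that arise
by deleting or contracting, in all possible ways, the edges from the last vertex to the first \<open>j\<close>
ones.\<close>

fun contractions :: "nat list \<Rightarrow> nat \<Rightarrow> nat list list" where
  "contractions ys 0 = [ys]"
| "contractions ys (Suc j) = contractions ys j @
     (if ys ! j = last ys then []
      else contractions (map (\<lambda>y. if y = last ys then ys ! j else y) ys) j)"

text \<open>Labellings in which the last vertex has been merged with none of the others are discarded, because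
they are not completed by any tree.\<close>

definition eliminate_last :: "nat list \<Rightarrow> nat list list" where
  "eliminate_last ys =
     map butlast (filter (\<lambda>zs. last zs \<in> set (butlast zs)) (contractions ys (length ys - 1)))"

text \<open>Only the vertices from \<open>k\<close> on have been merged so far; the earlier ones are still separate. The
sum type keeps their labels apart from all labels of the list.\<close>

definition window_label :: "nat \<Rightarrow> nat list \<Rightarrow> nat \<Rightarrow> nat + nat" where
  "window_label k ys x = (if x < k then Inr x else Inl (ys ! (x - k)))"

lemma length_contractions: "zs \<in> set (contractions ys j) \<Longrightarrow> length zs = length ys"
  by (induction ys j arbitrary: zs rule: contractions.induct) (auto split: if_splits)

lemma length_eliminate_last:
  "zs \<in> set (eliminate_last ys) \<Longrightarrow> length zs = length ys - 1"
  by (auto simp: eliminate_last_def dest: length_contractions)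

lemma contraction_count_contractions:
  assumes "length ys = Suc m" "j \<le> m" "set es \<subseteq> {..<k + Suc m} \<times> {..<k + Suc m}"
  shows "contraction_count {..<k + Suc m} (map (\<lambda>i. (k + m, k + i)) (rev [0..<j]) @ es) (window_label k ys) =
           (\<Sum>zs\<leftarrow>contractions ys j. contraction_count {..<k + Suc m} es (window_label k zs))"
  using assms
proof (induction j arbitrary: ys)
  case (Suc j)
  let ?es = "map (\<lambda>i. (k + m, k + i)) (rev [0..<j]) @ es"
  let ?zs = "map (\<lambda>y. if y = last ys then ys ! j else y) ys"
  have last: "ys ! m = last ys"
    using Suc.prems(1) by (metis diff_Suc_1 last_conv_nth length_0_conv nat.simps(3))
  have "contraction_count {..<k + Suc m} ?es (\<lambda>x. if window_label k ys x = window_label k ys (k + m)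
        then window_label k ys (k + j) else window_label k ys x) =
      contraction_count {..<k + Suc m} ?es (window_label k ?zs)"
    using Suc.prems by (intro contraction_count_cong) (auto simp: window_label_def last split: if_splits)
  moreover have "window_label k ys (k + m) = Inl (last ys)" "window_label k ys (k + j) = Inl (ys ! j)"
    by (simp_all add: window_label_def last)
  ultimately show ?case
    using Suc by (auto simp del: add_Suc_right)
qed simp

lemma contraction_count_eliminate_last:
  assumes "length ys = Suc m" "0 < m" "set es \<subseteq> {..<k + m} \<times> {..<k + m}"
  shows "contraction_count {..<k + Suc m} (map (\<lambda>i. (k + m, k + i)) (rev [0..<m]) @ es) (window_label k ys) =
           (\<Sum>zs\<leftarrow>eliminate_last ys. contraction_count {..<k + m} es (window_label k zs))"
proof -
  have V: "{..<k + Suc m} - {k + m} = {..<k + m}"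
    by auto
  have drop: "contraction_count {..<k + Suc m} es (window_label k zs) =
      (if last zs \<in> set (butlast zs) then contraction_count {..<k + m} es (window_label k (butlast zs)) else 0)"
    if "length zs = Suc m" for zs
  proof -
    have nth: "i < m \<Longrightarrow> butlast zs ! i = zs ! i" and last: "last zs = zs ! m" for i
      using that by (auto simp: nth_butlast last_conv_nth simp flip: length_0_conv)
    have "set (butlast zs) = set (map ((!) (butlast zs)) [0..<m])"
      using that map_nth[of "butlast zs"] by simp
    then have set: "set (butlast zs) = (!) zs ` {..<m}"
      by (auto simp: nth)
    show ?thesis
    proof (cases "last zs \<in> set (butlast zs)")
      case True
      then obtain i where i: "i < m" "zs ! m = zs ! i"
        by (auto simp: set last)
      have "contraction_count {..<k + Suc m} es (window_label k zs) =
          contraction_count ({..<k + Suc m} - {k + m}) es (window_label k zs)"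
        by (rule contraction_count_drop[where w = "k + i"])
           (use i assms(3) in \<open>auto simp: window_label_def V\<close>)
      also have "\<dots> = contraction_count {..<k + m} es (window_label k (butlast zs))"
        unfolding V by (rule contraction_count_cong) (use assms(3) in \<open>auto simp: window_label_def nth\<close>)
      finally show ?thesis
        using True by simp
    next
      case False
      have "contraction_count {..<k + Suc m} es (window_label k zs) = 0"
      proof (rule contraction_count_isolated[where v = "k + m" and w = "k"])
        fix x assume "x \<in> {..<k + Suc m} - {k + m}"
        then have "x < k \<or> x - k < m"
          by auto
        then show "window_label k zs x \<noteq> window_label k zs (k + m)"
          using False unfolding set last by (auto simp: window_label_def) (metis imageI lessThan_iff)
      qed (use assms in \<open>auto simp: V\<close>)
      then show ?thesis
        using False by simp
    qed
  qed
  have "contraction_count {..<k + Suc m} (map (\<lambda>i. (k + m, k + i)) (rev [0..<m]) @ es) (window_label k ys) =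
      (\<Sum>zs\<leftarrow>contractions ys m. contraction_count {..<k + Suc m} es (window_label k zs))"
    using assms by (intro contraction_count_contractions) auto
  also have "\<dots> = (\<Sum>zs\<leftarrow>contractions ys m. if last zs \<in> set (butlast zs)
      then contraction_count {..<k + m} es (window_label k (butlast zs)) else 0)"
    using assms(1) drop length_contractions by (intro arg_cong[where f = sum_list] map_cong refl) metis
  also have "\<dots> = (\<Sum>zs\<leftarrow>eliminate_last ys. contraction_count {..<k + m} es (window_label k zs))"
    using assms(1) by (simp add: eliminate_last_def sum_list_map_filter' o_def)
  finally show ?thesis .
qed

lemma band_edges_Suc_shift:
  "band_edges (Suc (k + 5)) = map (\<lambda>i. (k + 5, k + i)) (rev [0..<5]) @ band_edges (k + 5)"
  "m \<le> 5 \<Longrightarrow> band_edges (Suc m) = map (\<lambda>i. (m, i)) (rev [0..<m]) @ band_edges m"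
proof -
  have "[k..<k + 5] = map (\<lambda>i. k + i) [0..<5]"
    by (simp add: map_add_upt add.commute)
  then show "band_edges (Suc (k + 5)) = map (\<lambda>i. (k + 5, k + i)) (rev [0..<5]) @ band_edges (k + 5)"
    unfolding band_edges.simps(2) add_diff_cancel_right' by (simp only: rev_map map_map o_def)
qed simp

section \<open>The transfer recurrence for windows of five vertices\<close>

text \<open>Renaming every label to the position of its first occurrence picks one representative from each
class of labellings that describe the same partition.\<close>

definition first_index :: "'b list \<Rightarrow> 'b \<Rightarrow> nat" where
  "first_index xs x = length (takeWhile (\<lambda>y. y \<noteq> x) xs)"

definition canonical_labels :: "nat list \<Rightarrow> nat list" where
  "canonical_labels xs = map (first_index xs) xs"

lemma nth_first_index: "x \<in> set xs \<Longrightarrow> xs ! first_index xs x = x"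
  unfolding first_index_def by (induction xs) auto

lemma first_index_eq_iff: "x \<in> set xs \<Longrightarrow> y \<in> set xs \<Longrightarrow> first_index xs x = first_index xs y \<longleftrightarrow> x = y"
  by (metis nth_first_index)

lemma contraction_count_canonical_labels:
  assumes "length xs = m" "set es \<subseteq> {..<k + m} \<times> {..<k + m}"
  shows "contraction_count {..<k + m} es (window_label k (canonical_labels xs)) =
           contraction_count {..<k + m} es (window_label k xs)"
proof (rule contraction_count_cong[OF _ assms(2)])
  fix x y assume "x \<in> {..<k + m}" "y \<in> {..<k + m}"
  then have "x < k \<or> x - k < length xs" "y < k \<or> y - k < length xs"
    using assms(1) by auto
  then show "window_label k (canonical_labels xs) x = window_label k (canonical_labels xs) y \<longleftrightarrow>
      window_label k xs x = window_label k xs y"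
    by (auto simp: window_label_def canonical_labels_def first_index_eq_iff)
qed

text \<open>The number of spanning trees of the fifth power of the path on \<open>k + 5\<close> vertices after its last five
vertices have been identified according to \<open>xs\<close>. It is integer-valued because the recurrence has
negative coefficients.\<close>

definition window_count :: "nat \<Rightarrow> nat list \<Rightarrow> int" where
  "window_count k xs = int (contraction_count {..<k + 5} (band_edges (k + 5)) (window_label k xs))"

text \<open>Eliminating the last vertex moves the window down by one, so that a new, still separate vertex
enters it at the front. The label 5 is fresh, as canonical labels of a window are at most 4.\<close>

definition successors :: "nat list \<Rightarrow> nat list list" where
  "successors xs = map canonical_labels (eliminate_last (5 # xs))"

lemma band_edges_subset: "set (band_edges n) \<subseteq> {..<n} \<times> {..<n}"
  by (auto simp: set_band_edges)

lemma window_count_Suc: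
  assumes "length xs = 5" "5 \<notin> set xs"
  shows "window_count (Suc k) xs = (\<Sum>zs\<leftarrow>successors xs. window_count k zs)"
proof -
  let ?n = "k + Suc 5"
  have "contraction_count {..<?n} (band_edges ?n) (window_label (Suc k) xs) =
      contraction_count {..<?n} (band_edges ?n) (window_label k (5 # xs))"
  proof (rule contraction_count_cong[OF _ band_edges_subset])
    fix x y assume "x \<in> {..<?n}" "y \<in> {..<?n}"
    then have cases: "z < k \<or> z = k \<or> (\<exists>i<5. z = Suc (k + i))" if "z = x \<or> z = y" for z
      using that by (metis add_Suc_right less_iff_Suc_add lessThan_iff linorder_neqE_nat nat_add_left_cancel_less Suc_less_eq)
    have "5 \<noteq> xs ! i" if "i < 5" for i
      using assms that by (metis nth_mem)
    then show "window_label (Suc k) xs x = window_label (Suc k) xs y \<longleftrightarrow>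
        window_label k (5 # xs) x = window_label k (5 # xs) y"
      using cases[of x] cases[of y] by (auto simp: window_label_def)
  qed
  also have "\<dots> = (\<Sum>zs\<leftarrow>eliminate_last (5 # xs).
      contraction_count {..<k + 5} (band_edges (k + 5)) (window_label k zs))"
    using contraction_count_eliminate_last[of "5 # xs" 5 "band_edges (k + 5)" k]
      assms(1) band_edges_subset
    by (simp only: add_Suc_right band_edges_Suc_shift(1)) simp
  also have "\<dots> = (\<Sum>zs\<leftarrow>eliminate_last (5 # xs).
      contraction_count {..<k + 5} (band_edges (k + 5)) (window_label k (canonical_labels zs)))"
    using assms(1) length_eliminate_last[of _ "5 # xs"]
    by (intro arg_cong[where f = sum_list] map_cong refl contraction_count_canonical_labels[symmetric]
        band_edges_subset) simp
  finally show ?thesis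
    by (simp add: window_count_def successors_def o_def add.commute flip: sum_list_of_nat)
qed

text \<open>On at most six vertices the graph is complete, so no new vertex enters and the window shrinks until
a single vertex is left.\<close>

fun complete_window_count :: "nat \<Rightarrow> nat list \<Rightarrow> nat" where
  "complete_window_count 0 xs = 1"
| "complete_window_count (Suc m) xs = (\<Sum>zs\<leftarrow>eliminate_last xs. complete_window_count m zs)"

lemma contraction_count_complete:
  assumes "length xs = Suc m" "m \<le> 5"
  shows "contraction_count {..<Suc m} (band_edges (Suc m)) (window_label 0 xs) = complete_window_count m xs"
  using assms
proof (induction m arbitrary: xs)
  case (Suc m)
  have "contraction_count {..<Suc (Suc m)} (band_edges (Suc (Suc m))) (window_label 0 xs) =
      (\<Sum>zs\<leftarrow>eliminate_last xs. contraction_count {..<Suc m} (band_edges (Suc m)) (window_label 0 zs))"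
    using contraction_count_eliminate_last[of xs "Suc m" "band_edges (Suc m)" 0] Suc.prems band_edges_subset[of "Suc m"]
    by (simp add: band_edges_Suc_shift(2)[of "Suc m"] del: band_edges.simps upt_Suc)
  also have "\<dots> = (\<Sum>zs\<leftarrow>eliminate_last xs. complete_window_count m zs)"
    using Suc length_eliminate_last[of _ xs] by (intro arg_cong[where f = sum_list] map_cong refl) simp
  finally show ?case
    by simp
qed simp

lemma window_count_0:
  assumes "length xs = 5"
  shows "window_count 0 xs = int (complete_window_count 4 xs)"
  using contraction_count_complete[of xs 4] assms by (simp add: window_count_def del: band_edges.simps)

lemma num_spanning_trees_eq_window_count:
  "int (num_spanning_trees (graph_power (path_graph (k + 5)) 5)) = window_count k [0, 1, 2, 3, 4]"
proof -
  have "[0, 1, 2, 3, 4] = [0..<5]"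
    by (simp add: upt_rec)
  have "contraction_count {..<k + 5} (band_edges (k + 5)) id =
      contraction_count {..<k + 5} (band_edges (k + 5)) (window_label k [0..<5])"
    by (rule contraction_count_cong[OF _ band_edges_subset]) (auto simp: window_label_def)
  then show ?thesis
    by (simp only: \<open>[0, 1, 2, 3, 4] = [0..<5]\<close> window_count_def) (simp add: num_spanning_trees_path_power)
qed

section \<open>The transfer matrix and its annihilating polynomial\<close>

text \<open>One canonical labelling for each of the 52 partitions of a set of five elements; the label at
position \<open>i\<close> is at most \<open>i\<close>, which bounds the search.\<close>

definition window_states :: "nat list list" where
  "window_states = filter (\<lambda>xs. canonical_labels xs = xs) (product_lists (map (\<lambda>i. [0..<Suc i]) [0..<5]))"

text \<open>The schematic goals compute finite data by rewriting; their instantiated right-hand sides are the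
explicit lists of states, of initial values and of successors.\<close>

schematic_goal window_states_eq: "window_states = ?S"
  unfolding window_states_def by code_simp

schematic_goal initial_vector_eq:
  "map (\<lambda>xs. int (complete_window_count 4 xs)) window_states = ?v"
  unfolding window_states_eq by code_simp

schematic_goal successors_window_states: "map successors window_states = ?I"
  unfolding window_states_eq by code_simp

definition state_index :: "nat list \<Rightarrow> nat" where
  "state_index = first_index window_states"

lemma first_index_nth:
  assumes "distinct xs" "i < length xs"
  shows "first_index xs (xs ! i) = i"
  unfolding first_index_def using assms
proof (induction xs arbitrary: i)
  case (Cons x xs)
  then show ?case
    by (cases i) auto
qed simp

lemma map_first_index_self: "distinct xs \<Longrightarrow> map (first_index xs) xs = [0..<length xs]"
  by (rule nth_equalityI) (auto simp: first_index_nth)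

lemma distinct_window_states: "distinct window_states"
  unfolding window_states_eq by code_simp

schematic_goal state_index_eqs: "map state_index window_states = ?is"
  unfolding state_index_def map_first_index_self[OF distinct_window_states]
  unfolding window_states_eq by (simp add: upt_rec)

lemmas state_indices = state_index_eqs[unfolded window_states_eq list.map list.inject simp_thms]

definition transfer_vector :: "int list \<Rightarrow> int list" where
  "transfer_vector v = map (\<lambda>xs. \<Sum>zs\<leftarrow>successors xs. v ! state_index zs) window_states"

lemma transfer_alt:
  "transfer_vector v = map (\<lambda>zss. \<Sum>zs\<leftarrow>zss. v ! state_index zs) (map successors window_states)"
  by (simp add: transfer_vector_def o_def)

text \<open>The transfer matrix as 52 linear forms in variables. Rewriting a vector of numerals with this
equation costs one matrix-vector product, with no further list lookups.\<close>

schematic_goal transfer_explicit: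
  "transfer_vector
    [a0, a1, a2, a3, a4, a5, a6, a7, a8, a9, a10, a11, a12, a13, a14, a15, a16, a17, a18,
     a19, a20, a21, a22, a23, a24, a25, a26, a27, a28, a29, a30, a31, a32, a33, a34, a35,
     a36, a37, a38, a39, a40, a41, a42, a43, a44, a45, a46, a47, a48, a49, a50, a51] = ?w"
  unfolding transfer_alt successors_window_states
  by (simp add: state_indices del: One_nat_def)

text \<open>Horner's scheme for the value of a polynomial at the transfer matrix, applied to the vector of
initial values. Compared with iterating the matrix, it keeps the intermediate numbers small: they
stay below \<open>10^8\<close> for \<open>E5\<close>.\<close>

fun horner_vector :: "int list \<Rightarrow> int list" where
  "horner_vector [] = map (\<lambda>_. 0) window_states"
| "horner_vector (c # cs) =
     map2 (\<lambda>a b. c * a + b) (map (\<lambda>xs. int (complete_window_count 4 xs)) window_states)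
       (transfer_vector (horner_vector cs))"

definition E5_coeffs :: "int list" where
  "E5_coeffs = [-1, 8, 5, -32, 40, 364, -2349, -2676, 2793, 7304, -80872, 276356, 79495, 294796,
     -37931, 390831, -755736, -361695, -854845, -282796, -717739, 717739, 282796, 854845,
     361695, 755736, -390831, 37931, -294796, -79495, -276356, 80872, -7304, -2793, 2676,
     2349, -364, -40, 32, -5, -8, 1]"

text \<open>The decisive computation: the polynomial \<open>E5\<close>, evaluated at the transfer matrix, annihilates the
initial vector.\<close>

lemma horner_vector_E5: "horner_vector E5_coeffs = map (\<lambda>_. 0) window_states"
  unfolding E5_coeffs_def horner_vector.simps initial_vector_eq
  unfolding window_states_eq list.map
  by (simp add: transfer_explicit)

lemma E5_eq: "E5 = Poly (map of_int E5_coeffs)"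
  unfolding E5_def E5_coeffs_def Let_def
  by (simp add: eval_nat_numeral one_pCons numeral_poly)

section \<open>The linear recurrence\<close>

lemma first_index_le: "i < length xs \<Longrightarrow> first_index xs (xs ! i) \<le> i"
  unfolding first_index_def
proof (induction xs arbitrary: i)
  case (Cons x xs)
  then show ?case
    by (cases i) auto
qed simp

lemma first_index_less_length: "x \<in> set xs \<Longrightarrow> first_index xs x < length xs"
  by (metis first_index_le in_set_conv_nth le_less_trans)

lemma canonical_labels_idem: "canonical_labels (canonical_labels xs) = canonical_labels xs"
proof -
  have "first_index (map (first_index xs) xs) (first_index xs x) = first_index xs x" if x: "x \<in> set xs" for x
  proof -
    have "takeWhile ((\<lambda>y. y \<noteq> first_index xs x) \<circ> first_index xs) xs = takeWhile (\<lambda>y. y \<noteq> x) xs"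
      using x by (intro takeWhile_cong) (auto simp: first_index_eq_iff)
    then show ?thesis
      by (simp add: first_index_def[of "map _ _"] takeWhile_map) (simp add: first_index_def)
  qed
  then show ?thesis
    by (simp add: canonical_labels_def)
qed

lemma canonical_labels_in_window_states:
  assumes "length xs = 5"
  shows "canonical_labels xs \<in> set window_states"
proof -
  have "canonical_labels xs \<in> set (product_lists (map (\<lambda>i. [0..<Suc i]) [0..<5]))"
    unfolding product_lists_set
    using assms first_index_le[of _ xs]
    by (auto simp: list_all2_conv_all_nth canonical_labels_def less_Suc_eq_le simp del: upt_Suc)
  then show ?thesis
    by (simp add: window_states_def canonical_labels_idem)
qed

lemma window_states_labels:
  assumes "xs \<in> set window_states"
  shows "length xs = 5" "5 \<notin> set xs"
  using assms unfolding window_states_eq by auto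

lemma successors_in_window_states:
  assumes "xs \<in> set window_states" "zs \<in> set (successors xs)"
  shows "zs \<in> set window_states"
proof -
  obtain ys where "ys \<in> set (eliminate_last (5 # xs))" "zs = canonical_labels ys"
    using assms(2) by (auto simp: successors_def)
  then show ?thesis
    using length_eliminate_last[of ys "5 # xs"] window_states_labels[OF assms(1)]
    by (simp add: canonical_labels_in_window_states)
qed

lemma transfer_map:
  "transfer_vector (map f window_states) = map (\<lambda>xs. \<Sum>zs\<leftarrow>successors xs. f zs) window_states"
proof -
  have "map f window_states ! state_index zs = f zs" if "zs \<in> set window_states" for zs
    using that by (simp add: state_index_def first_index_less_length nth_first_index)
  then show ?thesis
    unfolding transfer_vector_def using successors_in_window_states
    by (intro map_cong refl arg_cong[where f = sum_list]) blast
qed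

lemma sum_list_linear_combination:
  fixes c :: "nat \<Rightarrow> int"
  shows "(\<Sum>z\<leftarrow>zs. \<Sum>j<n. c j * g j z) = (\<Sum>j<n. c j * (\<Sum>z\<leftarrow>zs. g j z))"
  by (induction zs) (simp_all add: sum.distrib distrib_left)

text \<open>The matrix turns the window counts for \<open>j\<close> into those for \<open>j + 1\<close>, so the value of a polynomial at the
matrix becomes a linear combination of consecutive window counts.\<close>

lemma horner_vector_eq:
  "horner_vector cs = map (\<lambda>xs. \<Sum>j<length cs. cs ! j * window_count j xs) window_states"
proof (induction cs)
  case (Cons c cs)
  have "c * int (complete_window_count 4 xs) +
        (\<Sum>zs\<leftarrow>successors xs. \<Sum>j<length cs. cs ! j * window_count j zs) =
      (\<Sum>j<length (c # cs). (c # cs) ! j * window_count j xs)"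
    if xs: "xs \<in> set window_states" for xs
  proof -
    have "(\<Sum>zs\<leftarrow>successors xs. \<Sum>j<length cs. cs ! j * window_count j zs) =
        (\<Sum>j<length cs. cs ! j * window_count (Suc j) xs)"
      using window_states_labels[OF xs] by (simp add: window_count_Suc sum_list_linear_combination)
    then show ?thesis
      using window_states_labels[OF xs]
      by (simp add: window_count_0 sum.lessThan_Suc_shift del: sum.lessThan_Suc)
  qed
  then show ?case
    unfolding horner_vector.simps Cons.IH transfer_map
    by (auto simp: map2_map_map intro!: map_cong)
qed simp

text \<open>Every shift of the recurrence follows from the unshifted one, since all window counts are advanced
by the same linear map.\<close>

lemma window_count_recurrence:
  assumes "xs \<in> set window_states"
  shows "(\<Sum>j<42. E5_coeffs ! j * window_count (k + j) xs) = 0"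
  using assms
proof (induction k arbitrary: xs)
  case 0
  have "length E5_coeffs = 42"
    by (simp add: E5_coeffs_def)
  then show ?case
    using horner_vector_E5 0 unfolding horner_vector_eq by (simp add: map_eq_conv)
next
  case (Suc k)
  have "(\<Sum>j<42. E5_coeffs ! j * window_count (Suc k + j) xs) =
      (\<Sum>j<42. E5_coeffs ! j * (\<Sum>zs\<leftarrow>successors xs. window_count (k + j) zs))"
    using window_states_labels[OF Suc.prems] by (simp add: window_count_Suc)
  also have "\<dots> = (\<Sum>zs\<leftarrow>successors xs. \<Sum>j<42. E5_coeffs ! j * window_count (k + j) zs)"
    by (simp only: sum_list_linear_combination)
  also have "\<dots> = (\<Sum>zs\<leftarrow>successors xs. 0)"
    using Suc.IH successors_in_window_states[OF Suc.prems]
    by (intro arg_cong[where f = sum_list] map_cong) auto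
  finally show ?case
    by simp
qed

lemma E5_coeffs_antipalindromic:
  assumes "j < 42"
  shows "E5_coeffs ! (41 - j) = - E5_coeffs ! j"
proof -
  have "\<forall>j<42. E5_coeffs ! (41 - j) = - E5_coeffs ! j"
    unfolding E5_coeffs_def by (simp add: eval_nat_numeral All_less_Suc)
  then show ?thesis
    using assms by blast
qed

lemma coeff_E5: "coeff E5 j = (if j < 42 then of_int (E5_coeffs ! j) else 0)"
  by (auto simp: E5_eq nth_default_def E5_coeffs_def[THEN arg_cong[where f = length]])

abbreviation free_window :: "nat list" where
  "free_window \<equiv> [0, 1, 2, 3, 4]"

lemma free_window_in_window_states: "free_window \<in> set window_states"
  unfolding window_states_eq by simp

text \<open>The coefficients of a product of power series pair them in the opposite order; as \<open>E5\<close> is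
antipalindromic, this changes only the sign.\<close>

lemma window_count_reverse_recurrence:
  "(\<Sum>j<42. E5_coeffs ! j * window_count (k + (41 - j)) free_window) = 0"
proof -
  have "(\<Sum>j<42. E5_coeffs ! j * window_count (k + (41 - j)) free_window) =
      (\<Sum>j<42. E5_coeffs ! (42 - Suc j) * window_count (k + (41 - (42 - Suc j))) free_window)"
    by (rule sum.nat_diff_reindex[symmetric])
  also have "\<dots> = (\<Sum>j<42. - (E5_coeffs ! j * window_count (k + j) free_window))"
    by (intro sum.cong) (simp_all add: E5_coeffs_antipalindromic)
  finally show ?thesis
    using window_count_recurrence[OF free_window_in_window_states] by (simp add: sum_negf)
qed

text \<open>By Cayley's formula \<open>6^4\<close>, since the graph is complete on six vertices.\<close>

lemma window_count_1: "window_count 1 free_window = 1296"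
proof -
  have "(\<Sum>zs\<leftarrow>successors free_window. int (complete_window_count 4 zs)) = 1296"
    by code_simp
  moreover have "(\<Sum>zs\<leftarrow>successors free_window. window_count 0 zs) =
      (\<Sum>zs\<leftarrow>successors free_window. int (complete_window_count 4 zs))"
    using successors_in_window_states[OF free_window_in_window_states] window_states_labels(1)
    by (intro arg_cong[where f = sum_list] map_cong refl window_count_0) blast
  ultimately show ?thesis
    using window_count_Suc[of free_window 0] by simp
qed

section \<open>The generating function\<close>

theorem theorem6p1p4:
  shows "\<exists>M5 :: rat poly. degree M5 = 40 \<and>
    Abs_fps (\<lambda>m. of_nat (num_spanning_trees (graph_power (path_graph (m + 7)) 5)))
      = fps_of_poly M5 / fps_of_poly E5"
proof -
  define \<tau> :: "rat fps" where
    "\<tau> = Abs_fps (\<lambda>m. of_nat (num_spanning_trees (graph_power (path_graph (m + 7)) 5)))"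
  \<comment> \<open>The index shift by 2: \<open>w k\<close> belongs to the path on \<open>k + 5\<close> vertices, the series starts at 7.\<close>
  define w where "w k = window_count k free_window" for k
  have \<tau>_nth: "fps_nth \<tau> m = of_int (w (m + 2))" for m
  proof -
    have "int (num_spanning_trees (graph_power (path_graph (m + 7)) 5)) = w (m + 2)"
      using num_spanning_trees_eq_window_count[of "m + 2"] by (simp only: w_def add.assoc) simp
    then show ?thesis
      unfolding \<tau>_def fps_nth_Abs_fps by (metis of_int_of_nat_eq)
  qed
  define P where "P = fps_of_poly E5 * \<tau>"
  have P_nth: "fps_nth P n = of_int (\<Sum>j<Suc n. if j < 42 then E5_coeffs ! j * w (n - j + 2) else 0)" for n
    unfolding P_def fps_mult_nth atLeast0AtMost lessThan_Suc_atMost of_int_sum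
    by (intro sum.cong) (simp_all add: coeff_E5 \<tau>_nth)
  have recurrence: "(\<Sum>j<42. E5_coeffs ! j * w (k + (41 - j))) = 0" for k
    using window_count_reverse_recurrence[of k] by (simp add: w_def)
  have P_0: "fps_nth P n = 0" if "41 \<le> n" for n
  proof -
    have "(\<Sum>j<Suc n. if j < 42 then E5_coeffs ! j * w (n - j + 2) else 0) =
        (\<Sum>j<42. E5_coeffs ! j * w (n - j + 2))"
      using that by (intro sum.mono_neutral_cong_right) auto
    also have "\<dots> = (\<Sum>j<42. E5_coeffs ! j * w ((n - 39) + (41 - j)))"
      using that by (intro sum.cong) (auto simp: Suc_diff_le intro!: arg_cong[where f = w])
    finally show ?thesis
      using recurrence by (simp add: P_nth)
  qed
  \<comment> \<open>The recurrence already holds one step before the first term of the series. In the coefficient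
    of \<open>t^40\<close> exactly that earlier value, for the complete graph on six vertices, is missing.\<close>
  have P_40: "fps_nth P 40 = -1296"
  proof -
    have "40 - j + 2 = 1 + (41 - j)" if "j < 41" for j :: nat
      using that by simp
    then have "(\<Sum>j<41. E5_coeffs ! j * w (40 - j + 2)) = (\<Sum>j<41. E5_coeffs ! j * w (1 + (41 - j)))"
      by (intro sum.cong refl) (simp only: lessThan_iff)
    then have "(\<Sum>j<41. E5_coeffs ! j * w (40 - j + 2)) + E5_coeffs ! 41 * w 1 =
        (\<Sum>j<Suc 41. E5_coeffs ! j * w (1 + (41 - j)))"
      by (simp only: sum.lessThan_Suc) simp
    also have "\<dots> = 0"
      using recurrence[of 1] by simp
    finally have "(\<Sum>j<41. E5_coeffs ! j * w (40 - j + 2)) = -1296"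
      using window_count_1 by (simp add: w_def E5_coeffs_def)
    moreover have "(\<Sum>j<Suc 40. if j < 42 then E5_coeffs ! j * w (40 - j + 2) else 0) =
        (\<Sum>j<41. E5_coeffs ! j * w (40 - j + 2))"
      by (intro sum.cong) auto
    ultimately show ?thesis
      unfolding P_nth by (simp only:)
  qed
  define M5 where "M5 = Abs_poly (fps_nth P)"
  have coeff_M5: "coeff M5 n = fps_nth P n" for n
    unfolding M5_def using P_0 by (subst coeff_Abs_poly[of 40]) simp_all
  have "degree M5 = 40"
  proof (rule antisym)
    show "degree M5 \<le> 40"
      by (rule degree_le) (simp add: coeff_M5 P_0)
    show "40 \<le> degree M5"
      by (rule le_degree) (simp add: coeff_M5 P_40)
  qed
  moreover have "\<tau> = fps_of_poly M5 / fps_of_poly E5"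
  proof -
    have "fps_of_poly E5 \<noteq> 0"
      using fps_of_poly_E5_unit by (metis fps_zero_nth neg_equal_0_iff_equal zero_neq_one)
    moreover have "fps_of_poly M5 = fps_of_poly E5 * \<tau>"
      by (rule fps_ext) (simp add: coeff_M5 P_def)
    ultimately show ?thesis
      by simp
  qed
  ultimately show ?thesis
    unfolding \<tau>_def by blast
qed

end
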